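(* Let $\mathcal L$ be a finite distributive lattice and $U_o\sqcup U_c=\mathcal P(\mathcal L)$ a partition of its set of join-irreducible elements. Then $C(I^{U_o,U_c}(\mathcal L),I^m(\mathcal L))$ consists exactly of the points $w\in\mathbb{R}^{\mathcal L}$ satisfying $w_a+w_b<w_{a\vee b}+w_{a\odot_{U_o,U_c}b}$ for all diamond pairs $\{a,b\}$ in $\mathcal L$. This description is minimal: for each diamond pair, the set of points of $\overline{C(I^{U_o,U_c}(\mathcal L),I^m(\mathcal L))}$ where equality $w_a+w_b=w_{a\vee b}+w_{a\odot_{U_o,U_c}b}$ holds is a facet of this closed cone.
   Context: $\mathcal P(\mathcal L)$ is the poset of join-irreducible elements (non-minimal elements covering exactly one element); $\iota(a)=\{p\in\mathcal P(\mathcal L):p\le a\}$, a lattice isomorphism from $\mathcal L$ onto the lattice of order ideals (lower sets) of $\mathcal P(\mathcal L)$. For an order ideal $J$, $K(J)$ is the set of elements of $J\cap U_o$ together with the elements of $J\cap U_c$ maximal in $J$. For order ideals $J_1,J_2$ there is a unique order ideal $J'$ with $\mathbf 1_{K(J_1)}+\mathbf 1_{K(J_2)}=\mathbf 1_{K(J_1\cup J_2)}+\mathbf 1_{K(J')}$; set $a\odot_{U_o,U_c}b=\iota^{-1}(J')$ for $J_1=\iota(a)$, $J_2=\iota(b)$. $R=\mathbb{C}[X_a:a\in\mathcal L]$; $I^{U_o,U_c}(\mathcal L)$ is the kernel of $R\to\mathbb{C}[z_p,t]$, $X_a\mapsto t\prod_{p\in K(\iota(a))}z_p$; $I^m(\mathcal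 L)$ is generated by $X_aX_b$ for incomparable $a,b$. For $w\in\mathbb{R}^{\mathcal L}$, $\mathrm{in}_wp$ is the part of $p$ of minimal $w$-weight, $\mathrm{in}_wI$ the span of all $\mathrm{in}_wp$, $p\in I$, and $C(I,J)=\{w:\mathrm{in}_wI=J\}$. A diamond pair is a two-element set $\{a,b\}$ with $a\vee b$ covering $a$ and $b$ and both covering $a\wedge b$. *)

theory Defs
  imports "HOL-Analysis.Analysis" "HOL-Library.Poly_Mapping"
begin

section \<open>Complex polynomials in variables indexed by a type\<close>

text \<open>Monomials are finitely supported exponent vectors, polynomials are finitely supported
  families of coefficients; the ring structure is the convolution product of Poly_Mapping.\<close>

type_synonym 'v monomial = "'v \<Rightarrow>\<^sub>0 nat"
type_synonym 'v cpoly = "'v monomial \<Rightarrow>\<^sub>0 complex"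

definition Const :: "complex \<Rightarrow> 'v cpoly" where
  "Const c = Poly_Mapping.single 0 c"

definition Var :: "'v \<Rightarrow> 'v cpoly" where
  "Var v = Poly_Mapping.single (Poly_Mapping.single v 1) 1"

definition cscale :: "complex \<Rightarrow> 'v cpoly \<Rightarrow> 'v cpoly" where
  "cscale c f = Const c * f"

text \<open>The \<open>\<complex>\<close>-algebra homomorphism sending each variable \<open>v\<close> to \<open>g v\<close>.\<close>

definition poly_subst :: "('v \<Rightarrow> 'u cpoly) \<Rightarrow> 'v cpoly \<Rightarrow> 'u cpoly" where
  "poly_subst g f =
     (\<Sum>m\<in>Poly_Mapping.keys f. Const (Poly_Mapping.lookup f m) *
        (\<Prod>v\<in>Poly_Mapping.keys m. g v ^ Poly_Mapping.lookup m v))"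

text \<open>Over \<open>(*)\<close> a module span is the generated ideal; over \<open>cscale\<close> it is the complex linear span.\<close>

global_interpretation ideal: module "(*) :: 'v cpoly \<Rightarrow> 'v cpoly \<Rightarrow> 'v cpoly"
  defines ideal_generated = ideal.span
  by unfold_locales (simp_all only: distrib_left distrib_right mult.assoc mult_1_left)

global_interpretation cpoly: vector_space "cscale :: complex \<Rightarrow> 'v cpoly \<Rightarrow> 'v cpoly"
  defines complex_span = cpoly.span
proof
  fix c d :: complex and f g :: "'v cpoly"
  show "cscale c (f + g) = cscale c f + cscale c g"
    by (simp add: cscale_def distrib_left)
  show "cscale (c + d) f = cscale c f + cscale d f"
    by (simp add: cscale_def Const_def single_add distrib_right)
  show "cscale c (cscale d f) = cscale (c * d) f"
    by (simp add: cscale_def Const_def mult_single flip: mult.assoc)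
  show "cscale 1 f = f"
    by (simp add: cscale_def Const_def)
qed

section \<open>Initial ideals\<close>

definition weight :: "real ^ 'a \<Rightarrow> 'a::finite monomial \<Rightarrow> real" where
  "weight w m = (\<Sum>a\<in>UNIV. real (Poly_Mapping.lookup m a) * w $ a)"

definition initial_form :: "real ^ 'a \<Rightarrow> 'a::finite cpoly \<Rightarrow> 'a cpoly" where
  "initial_form w f =
     (\<Sum>m | m \<in> Poly_Mapping.keys f \<and> (\<forall>m'\<in>Poly_Mapping.keys f. weight w m \<le> weight w m').
        Poly_Mapping.single m (Poly_Mapping.lookup f m))"

definition initial_ideal :: "real ^ 'a \<Rightarrow> 'a::finite cpoly set \<Rightarrow> 'a cpoly set" where
  "initial_ideal w I = complex_span (initial_form w ` I)"

definition groebner_cone :: "'a::finite cpoly set \<Rightarrow> 'a cpoly set \<Rightarrow> (real ^ 'a) set" where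
  "groebner_cone I J = {w. initial_ideal w I = J}"

section \<open>Join-irreducibles and order ideals\<close>

definition covers :: "'a::order \<Rightarrow> 'a \<Rightarrow> bool" where
  "covers a b \<longleftrightarrow> b < a \<and> \<not> (\<exists>c. b < c \<and> c < a)"

definition join_irreducibles :: "'a::order set" where
  "join_irreducibles = {p. (\<exists>q. q < p) \<and> (\<exists>!q. covers p q)}"

definition order_ideal :: "'a::order set \<Rightarrow> bool" where
  "order_ideal J \<longleftrightarrow>
     J \<subseteq> join_irreducibles \<and> (\<forall>p\<in>J. \<forall>q\<in>join_irreducibles. q \<le> p \<longrightarrow> q \<in> J)"

definition iota :: "'a::order \<Rightarrow> 'a set" where
  "iota a = {p \<in> join_irreducibles. p \<le> a}"

definition K_set :: "'a::order set \<Rightarrow> 'a set \<Rightarrow> 'a set \<Rightarrow> 'a set" where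
  "K_set Uo Uc J = (J \<inter> Uo) \<union> {p \<in> J \<inter> Uc. \<forall>q\<in>J. p \<le> q \<longrightarrow> q = p}"

definition odot_ideal :: "'a::order set \<Rightarrow> 'a set \<Rightarrow> 'a set \<Rightarrow> 'a set \<Rightarrow> 'a set" where
  "odot_ideal Uo Uc J1 J2 =
     (THE J'. order_ideal J' \<and>
        (\<forall>p. indicator (K_set Uo Uc J1) p + indicator (K_set Uo Uc J2) p =
             indicator (K_set Uo Uc (J1 \<union> J2)) p + (indicator (K_set Uo Uc J') p :: nat)))"

definition odot :: "'a::order set \<Rightarrow> 'a set \<Rightarrow> 'a \<Rightarrow> 'a \<Rightarrow> 'a" where
  "odot Uo Uc a b = inv iota (odot_ideal Uo Uc (iota a) (iota b))"

definition diamond_pair :: "'a::lattice \<Rightarrow> 'a \<Rightarrow> bool" where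
  "diamond_pair a b \<longleftrightarrow> a \<noteq> b \<and>
     covers (sup a b) a \<and> covers (sup a b) b \<and> covers a (inf a b) \<and> covers b (inf a b)"

section \<open>The ideals\<close>

text \<open>The target ring has variables indexed by \<open>'a option\<close>: \<open>None\<close> is \<open>t\<close> and \<open>Some p\<close> is
  \<open>z\<^sub>p\<close>. The variables \<open>Some p\<close> with \<open>p\<close> not join-irreducible never occur in an image, so they
  do not affect the kernel.\<close>

definition hibi_map :: "'a set \<Rightarrow> 'a set \<Rightarrow> 'a::order cpoly \<Rightarrow> 'a option cpoly" where
  "hibi_map Uo Uc = poly_subst (\<lambda>a. Var None * (\<Prod>p\<in>K_set Uo Uc (iota a). Var (Some p)))"

definition hibi_ideal :: "'a set \<Rightarrow> 'a set \<Rightarrow> 'a::order cpoly set" where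
  "hibi_ideal Uo Uc = {f. hibi_map Uo Uc f = 0}"

definition monomial_ideal :: "'a::order cpoly set" where
  "monomial_ideal = ideal_generated {Var a * Var b | a b. \<not> a \<le> b \<and> \<not> b \<le> a}"

end

theory Submission
  imports Defs
begin

text \<open>
  Write \<open>D(a, b) = w(a \<squnion> b) + w(a \<odot> b) - w(a) - w(b)\<close>. An order ideal \<open>J\<close> is the lower closure of
  \<open>K(J)\<close>, so the largest element of a multichain can be read off the image of its monomial, and every
  fibre of the monomial map contains at most one chain monomial. If \<open>D > 0\<close> on all incomparable
  pairs, replacing \<open>X\<^sub>a X\<^sub>b\<close> by \<open>X\<^sub>a\<^sub>\<squnion>\<^sub>b X\<^sub>a\<^sub>\<odot>\<^sub>b\<close> increases the weight, so the chain monomial is the unique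
  heaviest one in its fibre and the initial ideal is spanned by the other monomials.

  Positivity on diamond pairs suffices: for \<open>a \<sqinter> b < c < a\<close> uniqueness of chain monomials gives
  \<open>D(a, b) = D(c, b) + D(a, c \<squnion> b) + D(c \<odot> b, a \<odot> (c \<squnion> b))\<close>, where every summand belongs to a smaller
  pair. No inequality can be omitted: doubling the weight \<open>3\<close> to the power of the height at the two
  elements of a diamond pair violates the inequality of this pair and of no other.
\<close>

section \<open>Finite distributive lattices\<close>

definition incomparable :: "'a::ord \<Rightarrow> 'a \<Rightarrow> bool" where
  "incomparable a b \<longleftrightarrow> \<not> a \<le> b \<and> \<not> b \<le> a"

lemma incomparable_commute: "incomparable a b \<longleftrightarrow> incomparable b a"
  by (auto simp: incomparable_def)

lemma inf_less_left_iff: "inf a b < a \<longleftrightarrow> \<not> a \<le> (b :: 'a::lattice)"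
  by (simp add: less_le inf.absorb_iff1 [symmetric])

lemma less_sup_left_iff: "a < sup a b \<longleftrightarrow> \<not> b \<le> (a :: 'a::lattice)"
  by (simp add: less_le eq_commute [of a "sup a b"] sup.absorb_iff1 [symmetric])

lemma incomparable_strict_bounds:
  fixes a b :: "'a::lattice"
  assumes "incomparable a b"
  shows "inf a b < a" "inf a b < b" "a < sup a b" "b < sup a b"
  using assms inf_less_left_iff [of a b] inf_less_left_iff [of b a]
    less_sup_left_iff [of a b] less_sup_left_iff [of b a]
  by (simp_all add: incomparable_def inf_commute sup_commute)

lemma sup_sup_absorb:
  fixes a b c :: "'a::lattice"
  shows "c \<le> a \<Longrightarrow> sup a (sup c b) = sup a b"
  by (simp add: sup.absorb1 flip: sup.assoc)

lemma incomparable_between: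
  fixes a b c :: "'a::distrib_lattice"
  assumes incomparable: "incomparable a b" and between: "inf a b < c" "c < a"
  shows "inf a (sup c b) = c" "sup c b < sup a b" "incomparable c b" "incomparable a (sup c b)"
proof -
  show meet: "inf a (sup c b) = c"
    using between by (simp add: inf_sup_distrib1 inf.absorb2 sup.absorb1 less_imp_le)
  have not_le: "\<not> a \<le> sup c b"
    using meet between(2) by (metis inf.absorb1 less_irrefl)
  with incomparable show "incomparable a (sup c b)"
    by (simp add: incomparable_def)
  have "sup c b \<le> sup a b"
    using between(2) by (simp add: le_supI1 less_imp_le)
  with not_le show "sup c b < sup a b"
    by (auto simp: less_le)
  have "\<not> c \<le> b"
    using between by (meson le_infI less_imp_le leD)
  moreover have "\<not> b \<le> c"
    using incomparable between(2) by (meson incomparable_def less_imp_le order_trans)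
  ultimately show "incomparable c b"
    by (simp add: incomparable_def)
qed

lemma exists_covered_above:
  fixes q p :: "'a::{finite,order}"
  assumes "q < p"
  shows "\<exists>r. q \<le> r \<and> covers p r"
proof -
  have "finite {r. q \<le> r \<and> r < p}" "{r. q \<le> r \<and> r < p} \<noteq> {}"
    using assms by auto
  then obtain r where r: "r \<in> {r. q \<le> r \<and> r < p}"
    and maximal: "\<forall>s\<in>{r. q \<le> r \<and> r < p}. r \<le> s \<longrightarrow> r = s"
    by (meson finite_has_maximal)
  then have "covers p r"
    unfolding covers_def by (auto dest: order_trans less_imp_le)
  with r show ?thesis by auto
qed

lemma join_irreducible_iff_greatest_below:
  fixes p :: "'a::{finite,order}"
  shows "p \<in> join_irreducibles \<longleftrightarrow> (\<exists>q<p. \<forall>r<p. r \<le> q)"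
proof
  assume "p \<in> join_irreducibles"
  then obtain q where covered: "covers p q" and unique: "\<And>r. covers p r \<Longrightarrow> r = q"
    by (auto simp: join_irreducibles_def)
  then have "r \<le> q" if "r < p" for r
    using exists_covered_above [OF that] by blast
  moreover have "q < p"
    using covered by (simp add: covers_def)
  ultimately show "\<exists>q<p. \<forall>r<p. r \<le> q"
    by blast
next
  assume "\<exists>q<p. \<forall>r<p. r \<le> q"
  then obtain q where below: "q < p" and greatest: "\<And>r. r < p \<Longrightarrow> r \<le> q"
    by blast
  have "covers p r \<longleftrightarrow> r = q" for r
  proof
    assume "covers p r"
    then show "r = q"
      using below greatest by (simp add: covers_def) (metis order_le_less)
  next
    assume "r = q"
    then show "covers p r"
      using below greatest by (simp add: covers_def) (metis leD)
  qed
  with below show "p \<in> join_irreducibles"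
    by (auto simp: join_irreducibles_def)
qed

lemma join_irreducible_prime:
  fixes p :: "'a::{finite,distrib_lattice}"
  assumes "p \<in> join_irreducibles" and "p \<le> sup a b"
  shows "p \<le> a \<or> p \<le> b"
proof (rule ccontr)
  assume "\<not> (p \<le> a \<or> p \<le> b)"
  then have "inf p a < p" "inf p b < p"
    by (simp_all add: inf_less_left_iff)
  moreover obtain q where "q < p" and greatest: "\<And>r. r < p \<Longrightarrow> r \<le> q"
    using assms(1) join_irreducible_iff_greatest_below by blast
  ultimately have "inf p (sup a b) \<le> q"
    by (simp add: inf_sup_distrib1)
  with \<open>q < p\<close> \<open>p \<le> sup a b\<close> show False
    by (simp add: inf.absorb1)
qed

lemma exists_join_irreducible_separating:
  fixes a b :: "'a::{finite,lattice}"
  assumes "\<not> a \<le> b"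
  shows "\<exists>p\<in>join_irreducibles. p \<le> a \<and> \<not> p \<le> b"
proof -
  have "finite {x. x \<le> a \<and> \<not> x \<le> b}" "{x. x \<le> a \<and> \<not> x \<le> b} \<noteq> {}"
    using assms by auto
  then obtain p where "p \<le> a" "\<not> p \<le> b"
    and minimal: "\<And>x. x \<le> a \<Longrightarrow> \<not> x \<le> b \<Longrightarrow> x \<le> p \<Longrightarrow> p = x"
    by (metis (no_types, lifting) finite_has_minimal mem_Collect_eq)
  have "inf p b < p"
    using \<open>\<not> p \<le> b\<close> by (simp add: inf_less_left_iff)
  moreover have "r \<le> inf p b" if "r < p" for r
    using minimal [of r] \<open>p \<le> a\<close> that by (auto intro: order_trans less_imp_le)
  ultimately have "p \<in> join_irreducibles"
    using join_irreducible_iff_greatest_below by blast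
  with \<open>p \<le> a\<close> \<open>\<not> p \<le> b\<close> show ?thesis by blast
qed

lemma covers_sup:
  fixes a b :: "'a::distrib_lattice"
  assumes "covers b (inf a b)"
  shows "covers (sup a b) a"
  unfolding covers_def
proof (intro conjI notI)
  have "\<not> b \<le> a"
    using assms by (auto simp: covers_def inf.absorb2)
  then show "a < sup a b"
    by (simp add: less_sup_left_iff)
  assume "\<exists>c. a < c \<and> c < sup a b"
  then obtain c where "a < c" "c < sup a b"
    by blast
  then have c_eq: "c = sup a (inf c b)"
    by (simp add: sup_inf_distrib1 sup.absorb2 inf.absorb1 less_imp_le)
  have "inf a b \<le> inf c b" "inf c b \<le> b"
    using \<open>a < c\<close> by (simp_all add: le_infI1 less_imp_le)
  then have "inf c b = inf a b \<or> inf c b = b"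
    using assms by (auto simp: covers_def order_le_less)
  then show False
    using \<open>a < c\<close> \<open>c < sup a b\<close> c_eq by auto
qed

lemma diamond_pair_iff:
  fixes a b :: "'a::distrib_lattice"
  shows "diamond_pair a b \<longleftrightarrow> covers a (inf a b) \<and> covers b (inf a b)"
  using covers_sup [of a b] covers_sup [of b a]
  by (auto simp: diamond_pair_def sup_commute inf_commute) (auto simp: covers_def)

lemma diamond_pair_incomparable:
  fixes a b :: "'a::lattice"
  shows "diamond_pair a b \<Longrightarrow> incomparable a b"
  by (auto simp: diamond_pair_def covers_def incomparable_def sup.absorb1 sup.absorb2)

lemma incomparable_not_diamond_pairE:
  fixes a b :: "'a::distrib_lattice"
  assumes "incomparable a b" "\<not> diamond_pair a b"
  obtains (left) c where "inf a b < c" "c < a" | (right) c where "inf a b < c" "c < b"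
  using assms incomparable_strict_bounds [OF assms(1)]
  unfolding diamond_pair_iff covers_def by blast

subsection \<open>Birkhoff's representation\<close>

lemma iota_subset_iff:
  fixes a b :: "'a::{finite,lattice}"
  shows "iota a \<subseteq> iota b \<longleftrightarrow> a \<le> b"
  unfolding iota_def using exists_join_irreducible_separating [of a b] by (auto intro: order_trans)

lemma iota_eq_iff:
  fixes a b :: "'a::{finite,lattice}"
  shows "iota a = iota b \<longleftrightarrow> a = b"
  by (metis iota_subset_iff order_antisym order_refl)

lemma iota_sup:
  fixes a b :: "'a::{finite,distrib_lattice}"
  shows "iota (sup a b) = iota a \<union> iota b"
  unfolding iota_def by (auto dest: join_irreducible_prime intro: le_supI1 le_supI2)

lemma iota_inf:
  fixes a b :: "'a::lattice"
  shows "iota (inf a b) = iota a \<inter> iota b"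
  unfolding iota_def by auto

lemma order_ideal_iota: "order_ideal (iota a)"
  unfolding order_ideal_def iota_def by (auto intro: order_trans)

lemma order_ideal_in_range_iota:
  fixes J :: "'a::{finite,distrib_lattice} set"
  assumes "order_ideal J"
  shows "J \<in> range iota"
proof -
  obtain z :: 'a where minimal: "\<not> x < z" for x
    using finite_has_minimal [of "UNIV :: 'a set"] by (auto simp: less_le)
  then have "iota z = {}"
    by (auto simp: iota_def join_irreducibles_def dest: less_le_trans)
  then have "finite {a. iota a \<subseteq> J}" "{a. iota a \<subseteq> J} \<noteq> {}"
    by auto
  then obtain a where "iota a \<subseteq> J" and maximal: "\<And>b. iota b \<subseteq> J \<Longrightarrow> a \<le> b \<Longrightarrow> a = b"
    by (metis (no_types, lifting) finite_has_maximal mem_Collect_eq)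
  have "p \<in> iota a" if "p \<in> J" for p
  proof -
    have "iota (sup a p) \<subseteq> J"
      using \<open>iota a \<subseteq> J\<close> assms that
      by (auto simp: iota_sup) (auto simp: iota_def order_ideal_def)
    then have "p \<le> a"
      using maximal [of "sup a p"] by (metis sup_ge1 sup_ge2)
    then show ?thesis
      using assms that by (auto simp: iota_def order_ideal_def)
  qed
  with \<open>iota a \<subseteq> J\<close> show ?thesis by blast
qed

definition height :: "'a::{finite,order} \<Rightarrow> nat" where
  "height a = card (iota a)"

lemma height_strict_mono:
  fixes a b :: "'a::{finite,lattice}"
  assumes "a < b"
  shows "height a < height b"
  using assms unfolding height_def
  by (intro psubset_card_mono) (auto simp: psubset_eq iota_subset_iff iota_eq_iff)

lemma height_covers:
  fixes a c :: "'a::{finite,distrib_lattice}"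
  assumes "covers a c"
  shows "height a = Suc (height c)"
proof -
  have "c < a"
    using assms by (simp add: covers_def)
  have sup_eq: "sup c p = a" if "p \<in> iota a" "p \<notin> iota c" for p
  proof -
    have "p \<le> a" "\<not> p \<le> c"
      using that by (auto simp: iota_def)
    then have "c < sup c p" "sup c p \<le> a"
      using \<open>c < a\<close> by (auto simp: less_sup_left_iff)
    then show ?thesis
      using assms by (auto simp: covers_def order_le_less)
  qed
  have difference_le: "p \<le> q" if "p \<in> iota a - iota c" "q \<in> iota a - iota c" for p q
    using that sup_eq [of q] join_irreducible_prime [of p c q] by (auto simp: iota_def)
  obtain p where difference: "p \<in> iota a - iota c"
    using \<open>c < a\<close> iota_subset_iff [of a c] by auto
  then have "iota a - iota c = {p}"
    using difference_le by (blast intro: order_antisym)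
  moreover have "iota c \<subseteq> iota a"
    using \<open>c < a\<close> by (simp add: iota_subset_iff)
  ultimately have "iota a = insert p (iota c)"
    by blast
  with difference show ?thesis
    by (simp add: height_def)
qed

lemma height_diamond_pair:
  fixes a b :: "'a::{finite,distrib_lattice}"
  assumes "diamond_pair a b"
  shows "height b = height a" "height (sup a b) = Suc (height a)"
  using assms height_covers [of "sup a b" a] height_covers [of "sup a b" b]
  by (simp_all add: diamond_pair_def)

section \<open>The operation \<open>\<odot>\<close> on order ideals\<close>

definition lower_closure :: "'a::order set \<Rightarrow> 'a set" where
  "lower_closure G = {q \<in> join_irreducibles. \<exists>p\<in>G. q \<le> p}"

lemma order_ideal_lower_closure: "order_ideal (lower_closure G)"
  by (auto simp: order_ideal_def lower_closure_def intro: order_trans)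

lemma lower_closure_UN: "lower_closure (\<Union>i\<in>I. G i) = (\<Union>i\<in>I. lower_closure (G i))"
  by (auto simp: lower_closure_def)

locale join_irreducible_partition =
  fixes Uo Uc :: "'a::{finite,order} set"
  assumes Un_eq: "Uo \<union> Uc = join_irreducibles"
    and Int_eq: "Uo \<inter> Uc = {}"
begin

abbreviation K :: "'a set \<Rightarrow> 'a set" where
  "K \<equiv> K_set Uo Uc"

lemma lower_closure_K:
  assumes "order_ideal J"
  shows "lower_closure (K J) = J"
proof
  show "lower_closure (K J) \<subseteq> J"
    using assms by (auto simp: lower_closure_def order_ideal_def K_set_def)
  show "J \<subseteq> lower_closure (K J)"
  proof
    fix q assume "q \<in> J"
    then have "finite {p \<in> J. q \<le> p}" "{p \<in> J. q \<le> p} \<noteq> {}"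
      by auto
    then obtain p where "p \<in> J" "q \<le> p" and maximal: "\<And>r. r \<in> J \<Longrightarrow> q \<le> r \<Longrightarrow> p \<le> r \<Longrightarrow> p = r"
      by (metis (no_types, lifting) finite_has_maximal mem_Collect_eq)
    have "J \<subseteq> Uo \<union> Uc"
      using assms by (simp add: Un_eq order_ideal_def)
    with \<open>p \<in> J\<close> \<open>q \<le> p\<close> maximal have "p \<in> K J"
      by (fastforce simp: K_set_def intro: order_trans)
    with \<open>q \<le> p\<close> \<open>q \<in> J\<close> assms show "q \<in> lower_closure (K J)"
      by (auto simp: lower_closure_def order_ideal_def)
  qed
qed

text \<open>The identity defining \<open>odot_ideal\<close> forces this set to be \<open>K J'\<close>.\<close>

definition odot_generators :: "'a set \<Rightarrow> 'a set \<Rightarrow> 'a set" where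
  "odot_generators J1 J2 = J1 \<inter> J2 \<inter> (K J1 \<union> K J2)"

lemma lower_closure_odot_generators_subset:
  assumes "order_ideal J1" "order_ideal J2"
  shows "lower_closure (odot_generators J1 J2) \<subseteq> J1 \<inter> J2"
  using assms by (auto simp: lower_closure_def odot_generators_def order_ideal_def)

lemma K_lower_closure_odot_generators:
  assumes "order_ideal J1" "order_ideal J2"
  shows "K (lower_closure (odot_generators J1 J2)) = odot_generators J1 J2"
proof
  let ?G = "odot_generators J1 J2"
  have generators_subset: "?G \<subseteq> lower_closure ?G"
    using assms by (auto simp: lower_closure_def odot_generators_def order_ideal_def)
  note closure_subset = lower_closure_odot_generators_subset [OF assms]
  show "K (lower_closure ?G) \<subseteq> ?G"
  proof
    fix p assume p_in_K: "p \<in> K (lower_closure ?G)"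
    show "p \<in> ?G"
    proof (cases "p \<in> Uo")
      case True
      then show ?thesis
        using p_in_K closure_subset by (auto simp: K_set_def odot_generators_def)
    next
      case False
      then have "p \<in> lower_closure ?G" "\<And>q. q \<in> lower_closure ?G \<Longrightarrow> p \<le> q \<Longrightarrow> q = p"
        using p_in_K by (auto simp: K_set_def)
      then show ?thesis
        using generators_subset unfolding lower_closure_def by blast
    qed
  qed
  show "?G \<subseteq> K (lower_closure ?G)"
    using generators_subset closure_subset by (auto simp: K_set_def odot_generators_def)
qed

lemma mem_K_Un_iff:
  assumes "order_ideal J1" "order_ideal J2" "p \<in> J1 \<union> J2"
  shows "p \<in> K (J1 \<union> J2) \<longleftrightarrow> (p \<in> J1 \<longrightarrow> p \<in> K J1) \<and> (p \<in> J2 \<longrightarrow> p \<in> K J2)"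
  using assms Int_eq unfolding K_set_def order_ideal_def by blast

lemma indicator_K_add:
  assumes "order_ideal J1" "order_ideal J2"
  shows "indicator (K J1) p + indicator (K J2) p =
    indicator (K (J1 \<union> J2)) p + (indicator (odot_generators J1 J2) p :: nat)"
proof (cases "p \<in> J1 \<union> J2")
  case True
  moreover have "K J1 \<subseteq> J1" "K J2 \<subseteq> J2"
    by (auto simp: K_set_def)
  ultimately show ?thesis
    using mem_K_Un_iff [OF assms True] by (auto simp: indicator_def odot_generators_def)
next
  case False
  then show ?thesis
    by (simp add: indicator_def odot_generators_def K_set_def)
qed

lemma odot_ideal_eq:
  assumes "order_ideal J1" "order_ideal J2"
  shows "odot_ideal Uo Uc J1 J2 = lower_closure (odot_generators J1 J2)"
  unfolding odot_ideal_def
proof (rule the_equality)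
  show "order_ideal (lower_closure (odot_generators J1 J2)) \<and>
    (\<forall>p. indicator (K J1) p + indicator (K J2) p = indicator (K (J1 \<union> J2)) p
       + (indicator (K (lower_closure (odot_generators J1 J2))) p :: nat))"
    using indicator_K_add [OF assms]
    by (simp add: order_ideal_lower_closure K_lower_closure_odot_generators [OF assms])
next
  fix J' assume solution: "order_ideal J' \<and> (\<forall>p. indicator (K J1) p + indicator (K J2) p =
    indicator (K (J1 \<union> J2)) p + (indicator (K J') p :: nat))"
  then have "indicator (K J') p = (indicator (odot_generators J1 J2) p :: nat)" for p
    using indicator_K_add [OF assms, of p] by simp
  then have "p \<in> K J' \<longleftrightarrow> p \<in> odot_generators J1 J2" for p
    by (simp add: indicator_def of_bool_eq_iff)
  then have "K J' = odot_generators J1 J2"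
    by blast
  with solution show "J' = lower_closure (odot_generators J1 J2)"
    using lower_closure_K by metis
qed

end

section \<open>Spans of monomials\<close>

abbreviation monomial_poly :: "'v monomial \<Rightarrow> 'v cpoly" where
  "monomial_poly m \<equiv> Poly_Mapping.single m 1"

lemma poly_mapping_eq_sum_single:
  "f = (\<Sum>m\<in>Poly_Mapping.keys f. Poly_Mapping.single m (Poly_Mapping.lookup f m))"
  by (rule poly_mapping_eqI) (simp add: lookup_sum lookup_single when_def in_keys_iff)

lemma keys_monomial_poly_diff:
  assumes "m \<noteq> n"
  shows "Poly_Mapping.keys (monomial_poly m - monomial_poly n) = {m, n}"
  using assms by (auto simp: in_keys_iff lookup_minus lookup_single when_def split: if_splits)

lemma cscale_single: "cscale c (Poly_Mapping.single m d) = Poly_Mapping.single m (c * d)"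
  by (simp add: cscale_def Const_def mult_single)

lemma lookup_cscale: "Poly_Mapping.lookup (cscale c f) m = c * Poly_Mapping.lookup f m"
  by (simp add: cscale_def Const_def Poly_Mapping.map.rep_eq when_def flip: mult_map_scale_conv_mult)

definition monomial_span :: "'v monomial set \<Rightarrow> 'v cpoly set" where
  "monomial_span M = {f. Poly_Mapping.keys f \<subseteq> M}"

lemma monomial_span_add: "f \<in> monomial_span M \<Longrightarrow> g \<in> monomial_span M \<Longrightarrow> f + g \<in> monomial_span M"
  using Poly_Mapping.keys_add [of f g] by (auto simp: monomial_span_def)

lemma subspace_monomial_span: "cpoly.subspace (monomial_span M)"
proof -
  have "cscale c f \<in> monomial_span M" if "f \<in> monomial_span M" for c f
    using that by (auto simp: monomial_span_def in_keys_iff lookup_cscale)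
  then show ?thesis
    by (auto simp: cpoly.subspace_def monomial_span_add) (simp add: monomial_span_def)
qed

lemma monomial_span_subset_complex_span:
  assumes "\<And>m. m \<in> M \<Longrightarrow> monomial_poly m \<in> A"
  shows "monomial_span M \<subseteq> complex_span A"
proof
  fix f assume f_in_span: "f \<in> monomial_span M"
  have "cscale (Poly_Mapping.lookup f m) (monomial_poly m) \<in> complex_span A"
    if "m \<in> Poly_Mapping.keys f" for m
    using f_in_span that assms
    by (intro cpoly.span_scale cpoly.span_base) (auto simp: monomial_span_def)
  then have "(\<Sum>m\<in>Poly_Mapping.keys f. Poly_Mapping.single m (Poly_Mapping.lookup f m)) \<in> complex_span A"
    by (intro cpoly.span_sum) (simp add: cscale_single)
  then show "f \<in> complex_span A"
    using poly_mapping_eq_sum_single [of f] by simp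
qed

lemma ideal_subspace_monomial_span:
  assumes "\<And>k m. m \<in> M \<Longrightarrow> k + m \<in> M"
  shows "ideal.subspace (monomial_span M)"
proof -
  have "c * f \<in> monomial_span M" if "f \<in> monomial_span M" for c f
    using that keys_mult [of c f] assms by (fastforce simp: monomial_span_def)
  then show ?thesis
    by (auto simp: ideal.subspace_def monomial_span_add) (simp add: monomial_span_def)
qed

lemma single_in_ideal_generated:
  assumes "g \<in> G"
  shows "Poly_Mapping.single (k + g) c \<in> ideal_generated (monomial_poly ` G)"
proof -
  have "Poly_Mapping.single (k + g) c = Poly_Mapping.single k c * monomial_poly g"
    by (simp add: mult_single)
  with assms show ?thesis
    by (simp add: ideal.span_scale ideal.span_base)
qed

lemma ideal_generated_monomials:
  "ideal_generated (monomial_poly ` G) = monomial_span {k + m | k m. m \<in> G}"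
proof
  let ?M = "{k + m | k m. m \<in> G}"
  show "ideal_generated (monomial_poly ` G) \<subseteq> monomial_span ?M"
  proof (rule ideal.span_minimal)
    show "monomial_poly ` G \<subseteq> monomial_span ?M"
      by (auto simp: monomial_span_def intro: exI [of _ 0])
    show "ideal.subspace (monomial_span ?M)"
    proof (rule ideal_subspace_monomial_span)
      fix j m assume "m \<in> ?M"
      then obtain k g where "m = k + g" "g \<in> G"
        by blast
      then have "j + m = (j + k) + g"
        by (simp add: add.assoc)
      with \<open>g \<in> G\<close> show "j + m \<in> ?M"
        by blast
    qed
  qed
  show "monomial_span ?M \<subseteq> ideal_generated (monomial_poly ` G)"
  proof
    fix f assume "f \<in> monomial_span ?M"
    then have keys_subset: "Poly_Mapping.keys f \<subseteq> ?M"
      by (simp add: monomial_span_def)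
    have "Poly_Mapping.single m c \<in> ideal_generated (monomial_poly ` G)"
      if "m \<in> Poly_Mapping.keys f" for m c
      using subsetD [OF keys_subset that] by (auto intro: single_in_ideal_generated)
    then have "(\<Sum>m\<in>Poly_Mapping.keys f. Poly_Mapping.single m (Poly_Mapping.lookup f m))
        \<in> ideal_generated (monomial_poly ` G)"
      by (intro ideal.span_sum)
    then show "f \<in> ideal_generated (monomial_poly ` G)"
      using poly_mapping_eq_sum_single [of f] by simp
  qed
qed

section \<open>Initial ideals of toric ideals\<close>

definition exponent_map :: "('v \<Rightarrow> 'u monomial) \<Rightarrow> 'v monomial \<Rightarrow> 'u monomial" where
  "exponent_map e m = (\<Sum>v\<in>Poly_Mapping.keys m. \<Sum>i<Poly_Mapping.lookup m v. e v)"

lemma exponent_map_single: "exponent_map e (Poly_Mapping.single v 1) = e v"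
  by (simp add: exponent_map_def)

lemma lookup_exponent_map:
  "Poly_Mapping.lookup (exponent_map e m) u =
     (\<Sum>v\<in>Poly_Mapping.keys m. Poly_Mapping.lookup m v * Poly_Mapping.lookup (e v) u)"
  by (simp add: exponent_map_def lookup_sum)

lemma exponent_map_add: "exponent_map e (m + n) = exponent_map e m + exponent_map e n"
proof (rule poly_mapping_eqI)
  show "Poly_Mapping.lookup (exponent_map e (m + n)) u =
      Poly_Mapping.lookup (exponent_map e m + exponent_map e n) u" for u
    unfolding lookup_add [of "exponent_map e m"] lookup_exponent_map
    by (rule setsum_keys_plus_distrib) (simp_all add: distrib_right)
qed

lemma keys_exponent_map:
  "Poly_Mapping.keys (exponent_map e m) = (\<Union>v\<in>Poly_Mapping.keys m. Poly_Mapping.keys (e v))"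
proof -
  have "Poly_Mapping.lookup (exponent_map e m) u = 0 \<longleftrightarrow>
      (\<forall>v\<in>Poly_Mapping.keys m. Poly_Mapping.lookup (e v) u = 0)" for u
    by (auto simp: lookup_exponent_map in_keys_iff)
  then have "u \<in> Poly_Mapping.keys (exponent_map e m) \<longleftrightarrow>
      (\<exists>v\<in>Poly_Mapping.keys m. u \<in> Poly_Mapping.keys (e v))" for u
    unfolding in_keys_iff [of u] by simp
  then show ?thesis
    by blast
qed

lemma finite_exponent_map_fibre:
  fixes e :: "'v::finite \<Rightarrow> 'u monomial"
  assumes "\<And>v. Poly_Mapping.lookup (e v) u > 0"
  shows "finite {m. exponent_map e m = x}"
proof (rule finite_imageD)
  have "Poly_Mapping.lookup m v \<le> Poly_Mapping.lookup (exponent_map e m) u" for m v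
  proof (cases "v \<in> Poly_Mapping.keys m")
    case True
    have "Poly_Mapping.lookup m v \<le> Poly_Mapping.lookup m v * Poly_Mapping.lookup (e v) u"
      using assms [of v] by simp
    also have "\<dots> \<le> Poly_Mapping.lookup (exponent_map e m) u"
      unfolding lookup_exponent_map using True
      by (intro member_le_sum [of v _ "\<lambda>v. Poly_Mapping.lookup m v * Poly_Mapping.lookup (e v) u"]) auto
    finally show ?thesis .
  qed (simp add: in_keys_iff)
  then have "Poly_Mapping.lookup ` {m. exponent_map e m = x}
      \<subseteq> PiE UNIV (\<lambda>_. {..Poly_Mapping.lookup x u})"
    by auto
  then show "finite (Poly_Mapping.lookup ` {m. exponent_map e m = x})"
    by (rule finite_subset) (simp add: finite_PiE)
qed (simp add: inj_on_def)

definition toric_ideal :: "('v \<Rightarrow> 'u monomial) \<Rightarrow> 'v cpoly set" where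
  "toric_ideal e = {f. poly_subst (\<lambda>v. monomial_poly (e v)) f = 0}"

lemma monomial_poly_power:
  "monomial_poly m ^ n = monomial_poly (\<Sum>i<n. m)"
  by (induction n) (simp_all add: mult_single add.commute)

lemma prod_monomial_poly:
  "(\<Prod>x\<in>A. monomial_poly (f x)) = monomial_poly (\<Sum>x\<in>A. f x)"
  by (induction A rule: infinite_finite_induct) (simp_all add: mult_single)

lemma toric_ideal_iff:
  "f \<in> toric_ideal e \<longleftrightarrow>
     (\<forall>x. (\<Sum>m | m \<in> Poly_Mapping.keys f \<and> exponent_map e m = x. Poly_Mapping.lookup f m) = 0)"
proof -
  have "poly_subst (\<lambda>v. monomial_poly (e v)) f =
      (\<Sum>m\<in>Poly_Mapping.keys f. Poly_Mapping.single (exponent_map e m) (Poly_Mapping.lookup f m))"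
    by (simp add: poly_subst_def Const_def monomial_poly_power prod_monomial_poly mult_single
        exponent_map_def)
  then show ?thesis
    by (simp add: toric_ideal_def poly_mapping_eq_iff fun_eq_iff lookup_sum lookup_single when_def
        sum.inter_filter del: lookup_inject)
qed

lemma binomial_in_toric_ideal:
  assumes "exponent_map e m = exponent_map e n"
  shows "monomial_poly m - monomial_poly n \<in> toric_ideal e"
proof (cases "m = n")
  case False
  have "{k. k \<in> {m, n} \<and> exponent_map e k = x} = (if x = exponent_map e m then {m, n} else {})" for x
    using assms by auto
  then show ?thesis
    using False
    by (simp add: toric_ideal_iff keys_monomial_poly_diff [OF False] lookup_minus lookup_single when_def)
qed (simp add: toric_ideal_iff)

lemma weight_add: "weight w (m + n) = weight w m + weight w n"
  by (simp add: weight_def lookup_add distrib_right sum.distrib)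

lemma weight_single: "weight w (Poly_Mapping.single a 1) = w $ a"
  by (simp add: weight_def lookup_single when_def if_distrib if_distribR cong: if_cong)

lemma lookup_initial_form:
  "Poly_Mapping.lookup (initial_form w f) m =
     (if \<forall>m'\<in>Poly_Mapping.keys f. weight w m \<le> weight w m' then Poly_Mapping.lookup f m else 0)"
  by (auto simp: initial_form_def lookup_sum lookup_single when_def in_keys_iff)

lemma initial_form_binomial:
  assumes "weight w m < weight w n"
  shows "initial_form w (monomial_poly m - monomial_poly n) = monomial_poly m"
proof (rule poly_mapping_eqI)
  have "m \<noteq> n"
    using assms by auto
  then show "Poly_Mapping.lookup (initial_form w (monomial_poly m - monomial_poly n)) k
      = Poly_Mapping.lookup (monomial_poly m) k" for k
    using assms unfolding lookup_initial_form keys_monomial_poly_diff [OF \<open>m \<noteq> n\<close>]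
    by (auto simp: lookup_minus lookup_single when_def)
qed

lemma heaviest_of_initial_ideal_subset:
  assumes initial_subset: "initial_ideal w (toric_ideal e) \<subseteq> monomial_span (- S)"
    and "n \<in> S" "exponent_map e m = exponent_map e n" "m \<noteq> n"
  shows "weight w m < weight w n"
proof (rule ccontr)
  let ?f = "monomial_poly m - monomial_poly n"
  assume "\<not> weight w m < weight w n"
  then have "n \<in> Poly_Mapping.keys (initial_form w ?f)"
    unfolding in_keys_iff lookup_initial_form keys_monomial_poly_diff [OF \<open>m \<noteq> n\<close>]
    using \<open>m \<noteq> n\<close> by (simp add: lookup_minus lookup_single)
  moreover have "initial_form w ?f \<in> initial_ideal w (toric_ideal e)"
    unfolding initial_ideal_def
    using assms(3) by (intro cpoly.span_base imageI binomial_in_toric_ideal)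
  ultimately show False
    using initial_subset \<open>n \<in> S\<close> by (auto simp: monomial_span_def)
qed

lemma heaviest_notin_keys_initial_form:
  assumes heaviest: "\<And>m. exponent_map e m = exponent_map e n \<Longrightarrow> m \<noteq> n \<Longrightarrow> weight w m < weight w n"
    and "f \<in> toric_ideal e"
  shows "n \<notin> Poly_Mapping.keys (initial_form w f)"
proof
  assume "n \<in> Poly_Mapping.keys (initial_form w f)"
  then have nonzero: "Poly_Mapping.lookup f n \<noteq> 0"
    and lightest: "\<And>m. m \<in> Poly_Mapping.keys f \<Longrightarrow> weight w n \<le> weight w m"
    by (auto simp: in_keys_iff lookup_initial_form split: if_splits)
  have "m = n" if "m \<in> Poly_Mapping.keys f" "exponent_map e m = exponent_map e n" for m
    using heaviest [OF that(2)] lightest [OF that(1)] by (meson not_le)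
  then have "{m. m \<in> Poly_Mapping.keys f \<and> exponent_map e m = exponent_map e n} = {n}"
    using nonzero by (auto simp: in_keys_iff)
  moreover have "(\<Sum>m | m \<in> Poly_Mapping.keys f \<and> exponent_map e m = exponent_map e n.
      Poly_Mapping.lookup f m) = 0"
    using \<open>f \<in> toric_ideal e\<close> unfolding toric_ideal_iff by blast
  ultimately show False
    using nonzero by simp
qed

theorem initial_ideal_toric_iff:
  assumes fibre_meets: "\<And>m. \<exists>n\<in>S. exponent_map e n = exponent_map e m"
  shows "initial_ideal w (toric_ideal e) = monomial_span (- S) \<longleftrightarrow>
    (\<forall>n\<in>S. \<forall>m. exponent_map e m = exponent_map e n \<longrightarrow> m \<noteq> n \<longrightarrow> weight w m < weight w n)"
    (is "_ \<longleftrightarrow> ?heaviest")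
proof
  assume "initial_ideal w (toric_ideal e) = monomial_span (- S)"
  then show ?heaviest
    using heaviest_of_initial_ideal_subset by blast
next
  assume heaviest: ?heaviest
  have "initial_form w f \<in> monomial_span (- S)" if "f \<in> toric_ideal e" for f
    using heaviest_notin_keys_initial_form [OF _ that] heaviest by (auto simp: monomial_span_def)
  then have "initial_ideal w (toric_ideal e) \<subseteq> monomial_span (- S)"
    unfolding initial_ideal_def by (intro cpoly.span_minimal subspace_monomial_span) auto
  moreover have "monomial_poly m \<in> initial_form w ` toric_ideal e" if "m \<in> - S" for m
  proof -
    obtain n where "n \<in> S" and same_fibre: "exponent_map e m = exponent_map e n"
      using fibre_meets by metis
    with heaviest that have "weight w m < weight w n"
      by blast
    from initial_form_binomial [OF this] show ?thesis
      using binomial_in_toric_ideal [OF same_fibre] by (metis image_eqI)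
  qed
  then have "monomial_span (- S) \<subseteq> initial_ideal w (toric_ideal e)"
    unfolding initial_ideal_def by (rule monomial_span_subset_complex_span)
  ultimately show "initial_ideal w (toric_ideal e) = monomial_span (- S)"
    by (rule subset_antisym)
qed

section \<open>Chain monomials\<close>

definition pair_monomial :: "'v \<Rightarrow> 'v \<Rightarrow> 'v monomial" where
  "pair_monomial a b = Poly_Mapping.single a 1 + Poly_Mapping.single b 1"

lemma keys_add_nat:
  "Poly_Mapping.keys (m + n :: 'v monomial) = Poly_Mapping.keys m \<union> Poly_Mapping.keys n"
  by (auto simp: in_keys_iff lookup_add)

lemma keys_pair_monomial: "Poly_Mapping.keys (pair_monomial a b) = {a, b}"
  by (simp add: pair_monomial_def keys_add_nat insert_commute)

lemma Var_mult_Var: "Var a * Var b = monomial_poly (pair_monomial a b)"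
  by (simp add: Var_def pair_monomial_def mult_single)

lemma weight_pair_monomial: "weight w (pair_monomial a b) = w $ a + w $ b"
  by (simp only: pair_monomial_def weight_add weight_single)

lemma exponent_map_pair_monomial: "exponent_map e (pair_monomial a b) = e a + e b"
  by (simp only: pair_monomial_def exponent_map_add exponent_map_single)

lemma monomial_split_single:
  assumes "a \<in> Poly_Mapping.keys (m :: 'v monomial)"
  obtains n where "m = n + Poly_Mapping.single a 1"
proof
  show "m = (m - Poly_Mapping.single a 1) + Poly_Mapping.single a 1"
    using assms
    by (intro poly_mapping_eqI) (auto simp: lookup_add lookup_minus lookup_single when_def in_keys_iff)
qed

definition chain_monomial :: "'a::ord monomial \<Rightarrow> bool" where
  "chain_monomial m \<longleftrightarrow> (\<forall>a\<in>Poly_Mapping.keys m. \<forall>b\<in>Poly_Mapping.keys m. \<not> incomparable a b)"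

lemma chain_monomial_add: "chain_monomial (m + n) \<Longrightarrow> chain_monomial m"
  by (auto simp: chain_monomial_def keys_add_nat)

lemma chain_monomial_pair_iff:
  "chain_monomial (pair_monomial a b) \<longleftrightarrow> \<not> incomparable a (b :: 'a::order)"
  by (auto simp: chain_monomial_def keys_pair_monomial incomparable_def)

lemma chain_monomial_has_top:
  fixes m :: "'a::order monomial"
  assumes "chain_monomial m" "m \<noteq> 0"
  shows "\<exists>c\<in>Poly_Mapping.keys m. \<forall>a\<in>Poly_Mapping.keys m. a \<le> c"
proof -
  have "finite (Poly_Mapping.keys m)" "Poly_Mapping.keys m \<noteq> {}"
    using assms(2) by auto
  then obtain c where "c \<in> Poly_Mapping.keys m" "\<forall>a\<in>Poly_Mapping.keys m. c \<le> a \<longrightarrow> c = a"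
    using finite_has_maximal by metis
  then show ?thesis
    using assms(1) by (auto simp: chain_monomial_def incomparable_def)
qed

lemma not_chain_monomial_iff:
  fixes m :: "'a::order monomial"
  shows "\<not> chain_monomial m \<longleftrightarrow> (\<exists>n a b. incomparable a b \<and> m = n + pair_monomial a b)"
proof
  assume "\<not> chain_monomial m"
  then obtain a b where in_keys: "a \<in> Poly_Mapping.keys m" "b \<in> Poly_Mapping.keys m"
    and incomparable: "incomparable a b"
    by (auto simp: chain_monomial_def)
  obtain k where m_eq: "m = k + Poly_Mapping.single a 1"
    using monomial_split_single [OF in_keys(1)] .
  have "b \<noteq> a"
    using incomparable by (auto simp: incomparable_def)
  then have "b \<in> Poly_Mapping.keys k"
    using in_keys(2) by (auto simp: m_eq keys_add_nat split: if_splits)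
  from monomial_split_single [OF this] obtain n where "k = n + Poly_Mapping.single b 1" .
  with m_eq have "m = n + pair_monomial a b"
    by (simp add: pair_monomial_def ac_simps)
  with incomparable show "\<exists>n a b. incomparable a b \<and> m = n + pair_monomial a b"
    by blast
next
  assume "\<exists>n a b. incomparable a b \<and> m = n + pair_monomial a b"
  then show "\<not> chain_monomial m"
    by (auto simp: chain_monomial_def keys_add_nat keys_pair_monomial)
qed

lemma monomial_ideal_eq: "monomial_ideal = monomial_span (- Collect chain_monomial)"
proof -
  let ?G = "{pair_monomial a b | a b :: 'a. incomparable a b}"
  have "{Var a * Var b | a b :: 'a. \<not> a \<le> b \<and> \<not> b \<le> a} = monomial_poly ` ?G"
    by (auto simp: Var_mult_Var incomparable_def)
  moreover have "{k + m | k m. m \<in> ?G} = - Collect chain_monomial"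
    unfolding Collect_neg_eq [symmetric] not_chain_monomial_iff by blast
  ultimately show ?thesis
    by (simp add: monomial_ideal_def ideal_generated_monomials)
qed

section \<open>The toric ideal of a partition\<close>

context join_irreducible_partition
begin

definition exponent :: "'a \<Rightarrow> 'a option monomial" where
  "exponent a =
     Poly_Mapping.single None 1 + (\<Sum>p\<in>K (iota a). Poly_Mapping.single (Some p) 1)"

lemma lookup_exponent_None [simp]: "Poly_Mapping.lookup (exponent a) None = 1"
  by (simp add: exponent_def lookup_add lookup_sum lookup_single)

lemma lookup_exponent_Some: "Poly_Mapping.lookup (exponent a) (Some p) = indicator (K (iota a)) p"
  by (simp add: exponent_def lookup_add lookup_sum lookup_single when_def indicator_def)

lemma hibi_ideal_eq_toric_ideal: "hibi_ideal Uo Uc = toric_ideal exponent"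
  by (simp add: hibi_ideal_def hibi_map_def toric_ideal_def exponent_def Var_def prod_monomial_poly
      mult_single)

lemma lower_closure_exponent_map:
  "lower_closure {p. Some p \<in> Poly_Mapping.keys (exponent_map exponent m)} =
     (\<Union>a\<in>Poly_Mapping.keys m. iota a)"
proof -
  have "Some p \<in> Poly_Mapping.keys (exponent a) \<longleftrightarrow> p \<in> K (iota a)" for p a
    by (simp add: in_keys_iff lookup_exponent_Some indicator_def)
  then have "{p. Some p \<in> Poly_Mapping.keys (exponent_map exponent m)} =
      (\<Union>a\<in>Poly_Mapping.keys m. K (iota a))"
    by (auto simp: keys_exponent_map)
  then show ?thesis
    by (simp add: lower_closure_UN lower_closure_K order_ideal_iota)
qed

lemma exponent_map_eq_0_iff: "exponent_map exponent m = 0 \<longleftrightarrow> m = 0"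
proof
  assume "exponent_map exponent m = 0"
  moreover have "exponent a \<noteq> 0" for a
    by (metis lookup_exponent_None lookup_zero zero_neq_one)
  ultimately show "m = 0"
    using keys_exponent_map [of exponent m] by auto
qed (simp add: exponent_map_def)

end

locale distributive_lattice_partition = join_irreducible_partition Uo Uc
  for Uo Uc :: "'a::{finite,distrib_lattice} set"
begin

lemma chain_monomials_common_top:
  assumes "chain_monomial m" "chain_monomial n" "m \<noteq> 0" "n \<noteq> 0"
    and same_fibre: "exponent_map exponent m = exponent_map exponent n"
  shows "\<exists>c. c \<in> Poly_Mapping.keys m \<and> c \<in> Poly_Mapping.keys n"
proof -
  have iota_top: "iota c = (\<Union>a\<in>Poly_Mapping.keys k. iota a)"
    if "c \<in> Poly_Mapping.keys k" "\<forall>a\<in>Poly_Mapping.keys k. a \<le> c" for c and k :: "'a monomial"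
    using that iota_subset_iff by blast
  obtain c where top_m: "c \<in> Poly_Mapping.keys m" "\<forall>a\<in>Poly_Mapping.keys m. a \<le> c"
    using chain_monomial_has_top assms(1,3) by blast
  obtain d where top_n: "d \<in> Poly_Mapping.keys n" "\<forall>a\<in>Poly_Mapping.keys n. a \<le> d"
    using chain_monomial_has_top assms(2,4) by blast
  have "iota c = iota d"
    unfolding iota_top [OF top_m] iota_top [OF top_n]
      lower_closure_exponent_map [symmetric] same_fibre ..
  with top_m(1) top_n(1) show ?thesis
    by (auto simp: iota_eq_iff)
qed

theorem chain_monomial_unique:
  assumes "chain_monomial m" "chain_monomial n" "exponent_map exponent m = exponent_map exponent n"
  shows "m = n"
  using assms
proof (induction "Poly_Mapping.lookup (exponent_map exponent m) None" arbitrary: m n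
    rule: less_induct)
  case less
  show ?case
  proof (cases "m = 0 \<or> n = 0")
    case True
    then show ?thesis
      using exponent_map_eq_0_iff less.prems(3) by metis
  next
    case False
    then obtain c where common: "c \<in> Poly_Mapping.keys m" "c \<in> Poly_Mapping.keys n"
      using chain_monomials_common_top less.prems by blast
    obtain m' where m_eq: "m = m' + Poly_Mapping.single c 1"
      using monomial_split_single [OF common(1)] .
    obtain n' where n_eq: "n = n' + Poly_Mapping.single c 1"
      using monomial_split_single [OF common(2)] .
    have "m' = n'"
    proof (rule less.hyps)
      show "chain_monomial m'" "chain_monomial n'"
        using less.prems(1,2) unfolding m_eq n_eq by (auto dest: chain_monomial_add)
      show "exponent_map exponent m' = exponent_map exponent n'"
        using less.prems(3) unfolding m_eq n_eq exponent_map_add by simp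
      show "Poly_Mapping.lookup (exponent_map exponent m') None
          < Poly_Mapping.lookup (exponent_map exponent m) None"
        unfolding m_eq exponent_map_add exponent_map_single by (simp add: lookup_add)
    qed
    then show ?thesis
      by (simp add: m_eq n_eq)
  qed
qed

subsection \<open>The operation \<open>\<odot>\<close> on the lattice\<close>

abbreviation odot_infix :: "'a \<Rightarrow> 'a \<Rightarrow> 'a" (infixl "\<odot>" 70) where
  "a \<odot> b \<equiv> odot Uo Uc a b"

lemma iota_odot: "iota (a \<odot> b) = lower_closure (odot_generators (iota a) (iota b))"
proof -
  have "odot_ideal Uo Uc (iota a) (iota b) = lower_closure (odot_generators (iota a) (iota b))"
    by (simp add: odot_ideal_eq order_ideal_iota)
  then show ?thesis
    by (simp add: odot_def f_inv_into_f order_ideal_in_range_iota order_ideal_lower_closure)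
qed

lemma odot_le_inf: "a \<odot> b \<le> inf a b"
proof -
  have "iota (a \<odot> b) \<subseteq> iota (inf a b)"
    unfolding iota_odot iota_inf
    by (intro lower_closure_odot_generators_subset order_ideal_iota)
  then show ?thesis
    by (simp add: iota_subset_iff)
qed

lemma odot_le_sup: "a \<odot> b \<le> sup a b"
  using odot_le_inf [of a b] by (auto intro: le_supI1)

lemma odot_less:
  assumes "incomparable a b"
  shows "a \<odot> b < a" "a \<odot> b < b"
  using incomparable_strict_bounds [OF assms] by (auto intro: le_less_trans [OF odot_le_inf])

lemma odot_commute: "a \<odot> b = b \<odot> a"
  by (simp add: odot_def odot_ideal_def Un_commute add.commute)

lemma exponent_odot: "exponent a + exponent b = exponent (sup a b) + exponent (a \<odot> b)"
proof (rule poly_mapping_eqI)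
  have "K (iota (a \<odot> b)) = odot_generators (iota a) (iota b)"
    unfolding iota_odot by (intro K_lower_closure_odot_generators order_ideal_iota)
  then show "Poly_Mapping.lookup (exponent a + exponent b) x =
      Poly_Mapping.lookup (exponent (sup a b) + exponent (a \<odot> b)) x" for x
    using indicator_K_add [OF order_ideal_iota [of a] order_ideal_iota [of b]]
    by (cases x) (simp_all add: lookup_add lookup_exponent_Some iota_sup)
qed

lemma odot_unique:
  assumes "d \<le> c" "exponent a + exponent b = exponent c + exponent d"
  shows "sup a b = c" "a \<odot> b = d"
proof -
  have "pair_monomial (sup a b) (a \<odot> b) = pair_monomial c d"
    using assms odot_le_sup exponent_odot [of a b]
    by (intro chain_monomial_unique)
      (simp_all add: chain_monomial_pair_iff incomparable_def exponent_map_pair_monomial)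
  then have "{sup a b, a \<odot> b} = {c, d}"
    using keys_pair_monomial by metis
  then show "sup a b = c" "a \<odot> b = d"
    using assms(1) odot_le_sup [of a b] by (metis doubleton_eq_iff order_antisym)+
qed

section \<open>The defect of a weight\<close>

definition defect :: "(real, 'a) vec \<Rightarrow> 'a \<Rightarrow> 'a \<Rightarrow> real" where
  "defect w a b = w $ sup a b + w $ (a \<odot> b) - w $ a - w $ b"

definition strictly_supermodular :: "(real, 'a) vec \<Rightarrow> bool" where
  "strictly_supermodular w \<longleftrightarrow> (\<forall>a b. incomparable a b \<longrightarrow> defect w a b > 0)"

lemma defect_commute: "defect w a b = defect w b a"
  by (simp add: defect_def odot_commute [of a b] sup_commute)

lemma defect_comparable:
  assumes "\<not> incomparable a b"
  shows "defect w a b = 0"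
proof -
  have "defect w a b = 0" if "a \<le> b" for a b
    using odot_unique [OF that, of a b] by (simp add: defect_def add.commute)
  then show ?thesis
    using assms defect_commute unfolding incomparable_def by metis
qed

lemma odot_interpolate:
  assumes "inf a b \<le> c" "c \<le> a"
  shows "sup (c \<odot> b) (a \<odot> sup c b) = c" "(c \<odot> b) \<odot> (a \<odot> sup c b) = a \<odot> b"
proof -
  have "a \<odot> b \<le> c"
    using odot_le_inf assms(1) order_trans by blast
  moreover have "exponent (c \<odot> b) + exponent (a \<odot> sup c b) = exponent c + exponent (a \<odot> b)"
  proof (rule poly_mapping_eqI)
    fix x
    let ?e = "\<lambda>a. Poly_Mapping.lookup (exponent a) x"
    have "?e y + ?e z = ?e (sup y z) + ?e (y \<odot> z)" for y z
      using arg_cong [OF exponent_odot, of "\<lambda>m. Poly_Mapping.lookup m x" y z]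
      by (simp add: lookup_add)
    from this [of c b] this [of a "sup c b"] this [of a b]
    show "Poly_Mapping.lookup (exponent (c \<odot> b) + exponent (a \<odot> sup c b)) x
        = Poly_Mapping.lookup (exponent c + exponent (a \<odot> b)) x"
      using assms(2) by (simp add: lookup_add sup_sup_absorb)
  qed
  ultimately show "sup (c \<odot> b) (a \<odot> sup c b) = c" "(c \<odot> b) \<odot> (a \<odot> sup c b) = a \<odot> b"
    by (rule odot_unique)+
qed

lemma defect_decompose:
  assumes "inf a b \<le> c" "c \<le> a"
  shows "defect w a b = defect w c b + defect w a (sup c b) + defect w (c \<odot> b) (a \<odot> sup c b)"
  using assms(2) by (simp add: defect_def odot_interpolate [OF assms] sup_sup_absorb)

lemma defect_pos_of_between:
  assumes incomparable: "incomparable a b" and between: "inf a b < c" "c < a"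
    and smaller_join: "\<And>x y. incomparable x y \<Longrightarrow> sup x y < sup a b \<Longrightarrow> defect w x y > 0"
    and larger_meet: "\<And>x y. incomparable x y \<Longrightarrow> sup x y = sup a b \<Longrightarrow> inf a b < inf x y \<Longrightarrow>
      defect w x y > 0"
  shows "defect w a b > 0"
proof -
  note subpairs = incomparable_between [OF incomparable between]
  have "defect w c b > 0"
    using subpairs(3,2) by (rule smaller_join)
  moreover have "defect w a (sup c b) > 0"
    using between subpairs by (intro larger_meet) (simp_all add: sup_sup_absorb less_imp_le)
  moreover have "defect w (c \<odot> b) (a \<odot> sup c b) \<ge> 0"
  proof (cases "incomparable (c \<odot> b) (a \<odot> sup c b)")
    case True
    have "c < sup a b"
      using between(2) by (rule less_le_trans) simp
    then show ?thesis
      using smaller_join [OF True] between by (simp add: odot_interpolate less_imp_le)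
  qed (simp add: defect_comparable)
  ultimately show ?thesis
    using defect_decompose [of a b c w] between by simp
qed

lemma defect_pos_of_diamond_pairs:
  assumes diamond: "\<And>a b. diamond_pair a b \<Longrightarrow> defect w a b > 0"
  shows "incomparable a b \<Longrightarrow> defect w a b > 0"
proof (induction "(a, b)" arbitrary: a b
    rule: wf_induct_rule [OF wf_measures [of "[\<lambda>(a, b). height (sup a b),
      \<lambda>(a, b). card (UNIV :: 'a set) - height (inf a b)]"], case_names less])
  case (less a b)
  have smaller_join: "defect w x y > 0" if "incomparable x y" "sup x y < sup a b" for x y
    using less.hyps [of x y] that(1) height_strict_mono [OF that(2)] by simp
  have larger_meet: "defect w x y > 0"
    if "incomparable x y" "sup x y = sup a b" "inf a b < inf x y" for x y
  proof -
    have "height (inf x y) \<le> card (UNIV :: 'a set)"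
      by (simp add: height_def card_mono)
    then show ?thesis
      using less.hyps [of x y] that(1,2) height_strict_mono [OF that(3)] by simp
  qed
  show ?case
  proof (cases "diamond_pair a b")
    case True
    then show ?thesis by (rule diamond)
  next
    case False
    with less.prems show ?thesis
    proof (cases rule: incomparable_not_diamond_pairE)
      case (left c)
      from defect_pos_of_between [OF less.prems this smaller_join larger_meet]
      show ?thesis .
    next
      case (right c)
      have "incomparable b a"
        using less.prems incomparable_commute by blast
      from defect_pos_of_between [of b a c, unfolded sup_commute [of b a] inf_commute [of b a],
          OF this right smaller_join larger_meet]
      show ?thesis
        by (simp only: defect_commute [of w a b])
    qed
  qed
qed

theorem strictly_supermodular_iff_diamond_pairs:
  "strictly_supermodular w \<longleftrightarrow> (\<forall>a b. diamond_pair a b \<longrightarrow> defect w a b > 0)"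
  using defect_pos_of_diamond_pairs diamond_pair_incomparable
  unfolding strictly_supermodular_def by blast

subsection \<open>Chain monomials as heaviest monomials\<close>

lemma exists_heavier_monomial:
  assumes "strictly_supermodular w" "\<not> chain_monomial m"
  shows "\<exists>n. exponent_map exponent n = exponent_map exponent m \<and> weight w m < weight w n"
proof -
  obtain k a b where "incomparable a b" and m_eq: "m = k + pair_monomial a b"
    using assms(2) not_chain_monomial_iff by blast
  let ?n = "k + pair_monomial (sup a b) (a \<odot> b)"
  have "exponent_map exponent ?n = exponent_map exponent m"
    by (simp add: m_eq exponent_map_add exponent_map_pair_monomial exponent_odot [of a b])
  moreover have "defect w a b > 0"
    using assms(1) \<open>incomparable a b\<close> by (simp add: strictly_supermodular_def)
  then have "weight w m < weight w ?n"
    by (simp add: m_eq weight_add weight_pair_monomial defect_def)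
  ultimately show ?thesis by blast
qed

lemma exists_chain_monomial_ge:
  assumes "strictly_supermodular w"
  shows "\<exists>n. chain_monomial n \<and> exponent_map exponent n = exponent_map exponent m
    \<and> weight w m \<le> weight w n"
proof -
  let ?F = "{k. exponent_map exponent k = exponent_map exponent m}"
  have "finite ?F"
    by (rule finite_exponent_map_fibre [of _ None]) simp
  then have finite_weights: "finite (weight w ` ?F)"
    by simp
  then have "Max (weight w ` ?F) \<in> weight w ` ?F"
    by (rule Max_in) blast
  then obtain n where "n \<in> ?F" and weight_n: "weight w n = Max (weight w ` ?F)"
    by auto
  have "weight w k \<le> weight w n" if "k \<in> ?F" for k
    unfolding weight_n using finite_weights that by (intro Max_ge) auto
  moreover from this have "chain_monomial n"
    using exists_heavier_monomial [OF assms, of n] \<open>n \<in> ?F\<close> by fastforce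
  ultimately show ?thesis
    using \<open>n \<in> ?F\<close> by auto
qed

lemma weight_less_chain_monomial:
  assumes "strictly_supermodular w" "chain_monomial n"
    and same_fibre: "exponent_map exponent m = exponent_map exponent n" and "m \<noteq> n"
  shows "weight w m < weight w n"
proof -
  have "\<not> chain_monomial m"
    using assms(2-4) chain_monomial_unique by blast
  then obtain k where fibre_k: "exponent_map exponent k = exponent_map exponent m"
    and "weight w m < weight w k"
    using exists_heavier_monomial [OF assms(1)] by blast
  moreover obtain l where "chain_monomial l" "weight w k \<le> weight w l"
    and fibre_l: "exponent_map exponent l = exponent_map exponent k"
    using exists_chain_monomial_ge [OF assms(1)] by blast
  moreover have "l = n"
    using \<open>chain_monomial l\<close> assms(2) same_fibre fibre_k fibre_l chain_monomial_unique by simp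
  ultimately show ?thesis
    by simp
qed

definition height_weight :: "(real, 'a) vec" where
  "height_weight = (\<chi> a. 3 ^ height a)"

lemma strictly_supermodular_height_weight: "strictly_supermodular height_weight"
  unfolding strictly_supermodular_def
proof (intro allI impI)
  fix a b :: 'a
  assume "incomparable a b"
  note incomparable_strict_bounds [OF this]
  then have "Suc (height a) \<le> height (sup a b)" "Suc (height b) \<le> height (sup a b)"
    using height_strict_mono Suc_leI by blast+
  then have "(3::real) ^ Suc (height a) \<le> 3 ^ height (sup a b)"
      "(3::real) ^ Suc (height b) \<le> 3 ^ height (sup a b)"
    by (auto intro!: power_increasing simp del: power_Suc)
  moreover have "(0::real) < 3 ^ height (a \<odot> b)" "(0::real) < 3 ^ height (sup a b)"
    by simp_all
  ultimately show "defect height_weight a b > 0"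
    unfolding defect_def height_weight_def vec_lambda_beta power_Suc by linarith
qed

lemma strictly_supermodular_of_heaviest:
  assumes heaviest: "\<And>m n. chain_monomial n \<Longrightarrow> exponent_map exponent m = exponent_map exponent n \<Longrightarrow>
    m \<noteq> n \<Longrightarrow> weight w m < weight w n"
  shows "strictly_supermodular w"
  unfolding strictly_supermodular_def
proof (intro allI impI)
  fix a b :: 'a
  assume "incomparable a b"
  let ?m = "pair_monomial a b" and ?n = "pair_monomial (sup a b) (a \<odot> b)"
  have "chain_monomial ?n" "\<not> chain_monomial ?m"
    using \<open>incomparable a b\<close> odot_le_sup by (auto simp: chain_monomial_pair_iff incomparable_def)
  then have "weight w ?m < weight w ?n"
    using exponent_odot [of a b] by (intro heaviest) (auto simp: exponent_map_pair_monomial)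
  then show "defect w a b > 0"
    by (simp add: weight_pair_monomial defect_def)
qed

theorem initial_ideal_hibi_iff:
  "initial_ideal w (hibi_ideal Uo Uc) = monomial_ideal \<longleftrightarrow> strictly_supermodular w"
proof -
  have fibre_meets: "\<exists>n\<in>Collect chain_monomial. exponent_map exponent n = exponent_map exponent m" for m
    using exists_chain_monomial_ge [OF strictly_supermodular_height_weight] by blast
  show ?thesis
    unfolding hibi_ideal_eq_toric_ideal monomial_ideal_eq initial_ideal_toric_iff [OF fibre_meets]
    using weight_less_chain_monomial strictly_supermodular_of_heaviest by blast
qed

corollary groebner_cone_hibi:
  "groebner_cone (hibi_ideal Uo Uc) monomial_ideal = {w. \<forall>a b. diamond_pair a b \<longrightarrow> defect w a b > 0}"
  by (simp add: groebner_cone_def initial_ideal_hibi_iff strictly_supermodular_iff_diamond_pairs)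

end

section \<open>Facets of dual cones\<close>

definition dual_cone :: "'e::real_inner set \<Rightarrow> 'e set" where
  "dual_cone V = {w. \<forall>v\<in>V. v \<bullet> w \<ge> 0}"

definition irredundant :: "'e::real_inner set \<Rightarrow> bool" where
  "irredundant V \<longleftrightarrow> (\<forall>u\<in>V. \<exists>w\<in>dual_cone (V - {u}). u \<bullet> w < 0)"

lemma dual_cone_eq_INT: "dual_cone V = (\<Inter>v\<in>V. dual_cone {v})"
  by (auto simp: dual_cone_def)

lemma closure_open_halfspaces_eq_dual_cone:
  fixes V :: "'e::euclidean_space set"
  assumes interior_point: "\<And>v. v \<in> V \<Longrightarrow> v \<bullet> x > 0"
  shows "closure {w. \<forall>v\<in>V. v \<bullet> w > 0} = dual_cone V"
proof -
  let ?F = "(\<lambda>v. {w. v \<bullet> w > 0}) ` V"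
  have "x \<in> \<Inter>?F"
    using interior_point by auto
  then have "closure (\<Inter>?F) = \<Inter>(closure ` ?F)"
    by (subst closure_Inter_convex_open) (auto simp: convex_halfspace_gt open_halfspace_gt)
  moreover have "closure {w. v \<bullet> w > 0} = {w. v \<bullet> w \<ge> 0}" if "v \<in> V" for v
    using interior_point [OF that] by (intro closure_halfspace_gt) auto
  moreover have "\<Inter>?F = {w. \<forall>v\<in>V. v \<bullet> w > 0}"
    by auto
  ultimately show ?thesis
    by (auto simp: dual_cone_def)
qed

lemma affine_hull_dual_cone:
  fixes V :: "'e::euclidean_space set"
  assumes "finite V" and interior_point: "\<And>v. v \<in> V \<Longrightarrow> v \<bullet> x > 0"
  shows "affine hull (dual_cone V) = UNIV"
proof -
  have "open {w. \<forall>v\<in>V. v \<bullet> w > 0}"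
    using \<open>finite V\<close> open_INT [of V "\<lambda>v. {w. v \<bullet> w > 0}"]
    by (simp add: open_halfspace_gt Collect_ball_eq)
  then have "{w. \<forall>v\<in>V. v \<bullet> w > 0} \<subseteq> interior (dual_cone V)"
    by (intro interior_maximal) (auto simp: dual_cone_def intro: less_imp_le)
  then show ?thesis
    using interior_point by (intro affine_hull_nonempty_interior) blast
qed

lemma irredundant_inj_on_halfspace:
  assumes "irredundant V"
  shows "inj_on (\<lambda>v. dual_cone {v}) V"
proof (rule inj_onI, rule ccontr)
  fix u v assume "u \<in> V" "v \<in> V" and same: "dual_cone {u} = dual_cone {v}" and "u \<noteq> v"
  obtain w where "w \<in> dual_cone (V - {u})" "u \<bullet> w < 0"
    using assms \<open>u \<in> V\<close> by (auto simp: irredundant_def)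
  then have "w \<in> dual_cone {v}" "w \<notin> dual_cone {u}"
    using \<open>v \<in> V\<close> \<open>u \<noteq> v\<close> by (auto simp: dual_cone_def)
  with same show False by blast
qed

lemma irredundant_dual_cone_psubset:
  assumes "irredundant V" "W \<subset> V"
  shows "dual_cone V \<subset> dual_cone W"
proof -
  obtain u where "u \<in> V" "u \<notin> W"
    using assms(2) by blast
  then obtain w where "w \<in> dual_cone (V - {u})" "u \<bullet> w < 0"
    using assms(1) by (auto simp: irredundant_def)
  then have "w \<in> dual_cone W" "w \<notin> dual_cone V"
    using assms(2) \<open>u \<in> V\<close> \<open>u \<notin> W\<close> by (auto simp: dual_cone_def not_le)
  moreover have "dual_cone V \<subseteq> dual_cone W"
    using assms(2) by (auto simp: dual_cone_def)
  ultimately show ?thesis by blast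
qed

theorem facet_of_dual_cone:
  fixes V :: "'e::euclidean_space set"
  assumes "finite V" "irredundant V" "u \<in> V"
    and interior_point: "\<And>v. v \<in> V \<Longrightarrow> v \<bullet> x > 0"
  shows "dual_cone V \<inter> {w. u \<bullet> w = 0} facet_of dual_cone V"
proof -
  define halfspace where "halfspace = (\<lambda>v :: 'e. dual_cone {v})"
  have cone_eq: "dual_cone W = \<Inter>(halfspace ` W)" for W
    unfolding halfspace_def by (rule dual_cone_eq_INT)
  have "inj_on halfspace V"
    unfolding halfspace_def using \<open>irredundant V\<close> by (rule irredundant_inj_on_halfspace)
  define normal where "normal = inv_into V halfspace"
  have normal_halfspace: "normal (halfspace v) = v" if "v \<in> V" for v
    using that \<open>inj_on halfspace V\<close> by (simp add: normal_def)
  have affine_hull: "affine hull (dual_cone V) = UNIV"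
    using \<open>finite V\<close> interior_point by (rule affine_hull_dual_cone)
  have "C facet_of dual_cone V \<longleftrightarrow>
      (\<exists>h. h \<in> halfspace ` V \<and> C = dual_cone V \<inter> {w. - normal h \<bullet> w = 0})" for C
  proof (rule facet_of_polyhedron_explicit)
    fix h assume "h \<in> halfspace ` V"
    then obtain v where "v \<in> V" "h = halfspace v"
      by blast
    then have "normal h = v" "h = {w. v \<bullet> w \<ge> 0}" "v \<noteq> 0"
      using normal_halfspace interior_point [of v] by (auto simp: halfspace_def dual_cone_def)
    then show "- normal h \<noteq> 0 \<and> h = {w. - normal h \<bullet> w \<le> 0}"
      by simp
  next
    fix H assume "H \<subset> halfspace ` V"
    then obtain W where "W \<subset> V" "H = halfspace ` W"
      by (metis psubset_eq subset_imageE)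
    then show "dual_cone V \<subset> affine hull (dual_cone V) \<inter> \<Inter>H"
      using irredundant_dual_cone_psubset [OF \<open>irredundant V\<close>] by (simp add: affine_hull flip: cone_eq)
  qed (simp_all add: \<open>finite V\<close> affine_hull flip: cone_eq)
  moreover have "{w. u \<bullet> w = 0} = {w. - normal (halfspace u) \<bullet> w = 0}"
    using \<open>u \<in> V\<close> by (simp add: normal_halfspace)
  ultimately show ?thesis
    using \<open>u \<in> V\<close> by blast
qed

section \<open>Minimality of the description\<close>

context distributive_lattice_partition
begin

lemma exists_weight_violating_only:
  assumes "diamond_pair a b"
  obtains w where "defect w a b < 0"
    "\<And>c d. diamond_pair c d \<Longrightarrow> {c, d} \<noteq> {a, b} \<Longrightarrow> defect w c d > 0"
proof
  define w :: "(real, 'a) vec" where "w = (\<chi> x. (if x \<in> {a, b} then 2 else 1) * 3 ^ height x)"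
  note incomparable = diamond_pair_incomparable [OF assms]
  have "sup a b \<notin> {a, b}" "a \<odot> b \<notin> {a, b}"
    using incomparable_strict_bounds [OF incomparable] odot_less [OF incomparable] by auto
  moreover have "(3::real) ^ height (a \<odot> b) < 3 ^ height a"
    using height_strict_mono [OF odot_less(1) [OF incomparable]] by simp
  ultimately show "defect w a b < 0"
    using height_diamond_pair [OF assms] by (simp add: defect_def w_def)
  show "defect w c d > 0" if "diamond_pair c d" "{c, d} \<noteq> {a, b}" for c d
  proof -
    have weight_ge: "w $ x \<ge> 3 ^ height x" for x
      by (simp add: w_def)
    note heights = height_diamond_pair [OF \<open>diamond_pair c d\<close>]
    have "c \<noteq> d"
      using that(1) by (simp add: diamond_pair_def)
    then have "w $ c + w $ d \<le> 3 * 3 ^ height c"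
      using that(2) heights(1) by (auto simp: w_def)
    also have "\<dots> \<le> w $ sup c d"
      using weight_ge [of "sup c d"] heights(2) by simp
    also have "\<dots> < w $ sup c d + w $ (c \<odot> d)"
      using less_le_trans [OF _ weight_ge [of "c \<odot> d"]] by simp
    finally show ?thesis
      by (simp add: defect_def)
  qed
qed

definition defect_vector :: "'a \<Rightarrow> 'a \<Rightarrow> (real, 'a) vec" where
  "defect_vector a b = axis (sup a b) 1 + axis (a \<odot> b) 1 - axis a 1 - axis b 1"

definition diamond_vectors :: "(real, 'a) vec set" where
  "diamond_vectors = {defect_vector a b | a b. diamond_pair a b}"

lemma inner_defect_vector: "defect_vector a b \<bullet> w = defect w a b"
  by (simp add: defect_vector_def defect_def inner_diff_left inner_add_left inner_axis')

lemma defect_vector_commute: "defect_vector a b = defect_vector b a"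
  by (simp add: defect_vector_def odot_commute [of a b] sup_commute)

lemma finite_diamond_vectors: "finite diamond_vectors"
  by (rule finite_subset [of _ "(\<lambda>(a, b). defect_vector a b) ` UNIV"])
    (auto simp: diamond_vectors_def)

lemma irredundant_diamond_vectors: "irredundant diamond_vectors"
  unfolding irredundant_def
proof
  fix u assume "u \<in> diamond_vectors"
  then obtain a b where diamond: "diamond_pair a b" and u_eq: "u = defect_vector a b"
    by (auto simp: diamond_vectors_def)
  obtain w where violated: "defect w a b < 0"
    and satisfied: "\<And>c d. diamond_pair c d \<Longrightarrow> {c, d} \<noteq> {a, b} \<Longrightarrow> defect w c d > 0"
    using exists_weight_violating_only [OF diamond] by blast
  have "v \<bullet> w \<ge> 0" if other: "v \<in> diamond_vectors - {u}" for v
  proof -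
    obtain c d where "diamond_pair c d" and v_eq: "v = defect_vector c d"
      using other by (auto simp: diamond_vectors_def)
    moreover have "{c, d} \<noteq> {a, b}"
      using other u_eq v_eq defect_vector_commute by (auto simp: doubleton_eq_iff)
    ultimately show ?thesis
      using satisfied by (simp add: inner_defect_vector less_imp_le)
  qed
  with violated show "\<exists>w\<in>dual_cone (diamond_vectors - {u}). u \<bullet> w < 0"
    by (auto simp: dual_cone_def u_eq inner_defect_vector)
qed

lemma diamond_vectors_height_weight_pos: "v \<in> diamond_vectors \<Longrightarrow> v \<bullet> height_weight > 0"
  using strictly_supermodular_height_weight
  by (auto simp: diamond_vectors_def inner_defect_vector strictly_supermodular_iff_diamond_pairs)

lemma closure_groebner_cone_hibi:
  "closure (groebner_cone (hibi_ideal Uo Uc) monomial_ideal) = dual_cone diamond_vectors"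
proof -
  have "groebner_cone (hibi_ideal Uo Uc) monomial_ideal = {w. \<forall>v\<in>diamond_vectors. v \<bullet> w > 0}"
    unfolding groebner_cone_hibi diamond_vectors_def by (auto simp flip: inner_defect_vector)
  then show ?thesis
    by (simp add: closure_open_halfspaces_eq_dual_cone [OF diamond_vectors_height_weight_pos])
qed

theorem diamond_pair_facet:
  assumes "diamond_pair a b"
  shows "{w \<in> closure (groebner_cone (hibi_ideal Uo Uc) monomial_ideal). defect w a b = 0}
    facet_of closure (groebner_cone (hibi_ideal Uo Uc) monomial_ideal)"
proof -
  have "defect_vector a b \<in> diamond_vectors"
    using assms by (auto simp: diamond_vectors_def)
  from facet_of_dual_cone [OF finite_diamond_vectors irredundant_diamond_vectors this
      diamond_vectors_height_weight_pos]
  show ?thesis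
    by (simp add: closure_groebner_cone_hibi inner_defect_vector Int_def)
qed

end

theorem theorem5p7:
  fixes Uo Uc :: "'a::{finite,distrib_lattice} set"
  assumes "Uo \<union> Uc = join_irreducibles"
    and "Uo \<inter> Uc = {}"
  shows "groebner_cone (hibi_ideal Uo Uc) monomial_ideal =
      {w. \<forall>a b. diamond_pair a b \<longrightarrow>
         w $ a + w $ b < w $ sup a b + w $ odot Uo Uc a b} \<and>
    (\<forall>a b. diamond_pair a b \<longrightarrow>
      {w \<in> closure (groebner_cone (hibi_ideal Uo Uc) monomial_ideal).
         w $ a + w $ b = w $ sup a b + w $ odot Uo Uc a b}
      facet_of closure (groebner_cone (hibi_ideal Uo Uc) monomial_ideal))"
proof -
  interpret distributive_lattice_partition Uo Uc
    using assms by unfold_locales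
  have "defect w a b > 0 \<longleftrightarrow> w $ a + w $ b < w $ sup a b + w $ odot Uo Uc a b"
    and "defect w a b = 0 \<longleftrightarrow> w $ a + w $ b = w $ sup a b + w $ odot Uo Uc a b" for w a b
    by (auto simp: defect_def)
  then show ?thesis
    using groebner_cone_hibi diamond_pair_facet by simp
qed

end
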